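(* Let $f\in\mathcal{U}$ with Taylor expansion $f(z)=z+a_2z^2+a_3z^3+\cdots$ in $\mathbb{D}$, and let $H_2(3)(f)=a_3a_5-a_4^2$. Then: (a) if $a_2=0$, then $|H_2(3)(f)|\le 1$, and this result is sharp due to the function $f(z)=\frac{z}{1-z^2}=z+z^3+z^5+\cdots$ (which belongs to $\mathcal{U}$, has $a_2=0$, and attains equality); (b) $|H_2(3)(f)|\le 1.4846575\ldots$ for every $f\in\mathcal{U}$.
   Context: $\mathbb{D}=\{z\in\mathbb{C}:|z|<1\}$. $\mathcal{A}$ is the class of functions $f$ analytic in $\mathbb{D}$ and normalized by $f(0)=0$, $f'(0)=1$, i.e. $f(z)=z+a_2z^2+a_3z^3+\cdots$. The class $\mathcal{U}$ is $$\mathcal{U}=\left\{f\in\mathcal{A}:\left|\left[\frac{z}{f(z)}\right]^2f'(z)-1\right|<1,\ z\in\mathbb{D}\right\},$$ where $z/f(z)$ is understood to have the value $1$ at $z=0$ (and membership includes that $f(z)\neq0$ for $0<|z|<1$, so that the expression is defined). For a function $f\in\mathcal{A}$ the second order Hankel determinant is $H_2(n)(f)=a_na_{n+2}-a_{n+1}^2$. A decimal followed by dots denotes a real constant whose decimal expansion begins with the displayed digits: $1.4846575\ldots$ is a constant $C$ with $1.4846575\le C<1.4846576$. *)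

theory Defs
  imports "HOL-Complex_Analysis.Complex_Analysis"
begin

definition class_A :: "(complex \<Rightarrow> complex) set" where
  "class_A = {f. f holomorphic_on ball 0 1 \<and> f 0 = 0 \<and> deriv f 0 = 1}"

text \<open>
  The function \<open>z / f z\<close> with its removable singularity at \<open>0\<close> filled by the value \<open>1\<close>.
\<close>

definition z_over :: "(complex \<Rightarrow> complex) \<Rightarrow> complex \<Rightarrow> complex" where
  "z_over f z = (if z = 0 then 1 else z / f z)"

text \<open>
  Since \<open>x / 0 = 0\<close> in HOL, the condition that \<open>f\<close> has no zero in the punctured disc
  has to be stated explicitly.
\<close>

definition class_U :: "(complex \<Rightarrow> complex) set" where
  "class_U = {f \<in> class_A.
     (\<forall>z\<in>ball 0 1 - {0}. f z \<noteq> 0) \<and>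
     (\<forall>z\<in>ball 0 1. norm ((z_over f z)\<^sup>2 * deriv f z - 1) < 1)}"

definition taylor_coeff :: "(complex \<Rightarrow> complex) \<Rightarrow> nat \<Rightarrow> complex" where
  "taylor_coeff f n = fps_nth (fps_expansion f 0) n"

definition hankel2 :: "nat \<Rightarrow> (complex \<Rightarrow> complex) \<Rightarrow> complex" where
  "hankel2 n f =
     taylor_coeff f n * taylor_coeff f (n + 2) - (taylor_coeff f (n + 1))\<^sup>2"

end

theory Submission
  imports Defs
begin

text \<open>
  Write \<open>p = z / f\<close>. For \<open>f\<close> in the class, \<open>p - z p' - 1\<close> has modulus below \<open>1\<close> and vanishes
  to second order at \<open>0\<close>, so it equals \<open>z\<^sup>2 \<phi>(z)\<close> with \<open>\<phi>\<close> bounded by \<open>1\<close>. Let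
  \<open>c, d, e\<close> be the first three Taylor coefficients of \<open>\<phi>\<close>. Together with \<open>a = a\<^sub>2\<close> they
  determine \<open>a\<^sub>3, a\<^sub>4, a\<^sub>5\<close>, and most terms of the determinant cancel:
  \<open>H = (a\<^sup>2 + c) e / 3 - a c d + c\<^sup>3 - d\<^sup>2 / 4\<close>, where moreover \<open>a\<^sup>2 + c = a\<^sub>3\<close>.

  Two groups of estimates enter. The Schwarz-Pick argument, applied to \<open>\<phi>\<close> and once more to the
  function that it produces, gives \<open>|d| \<le> 1 - |c|\<^sup>2\<close> and
  \<open>|e| \<le> 1 - |c|\<^sup>2 - |d|\<^sup>2 / (1 + |c|)\<close> (lemmas \<open>schur_coeff_1\<close> and \<open>schur_coeff_2\<close>).
  The bounds \<open>|a\<^sub>2| \<le> 2\<close> and \<open>|a\<^sub>3| \<le> 3\<close>, which hold for all univalent functions, have a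
  short proof here: \<open>p = (1 + w)\<^sup>2\<close> with \<open>w 0 = 0\<close> and \<open>|w| < 1\<close> (lemma \<open>class_U_sqrt\<close>),
  because at a first point with \<open>|w| = 1\<close> Jack's lemma would force \<open>|p - z p' - 1| \<ge> 1\<close>.

  With \<open>x = |c|\<close> and \<open>y = |d| / 2\<close> both bounds become inequalities in two real variables. If \<open>a = 0\<close> the bound is \<open>1\<close>, attained at \<open>x = 1\<close>. In general the maximum lies on
  the boundary curve \<open>y = (1 - x\<^sup>2) / 2\<close>, where the bound reads
  \<open>3 x - 2 x\<^sup>3 + (1 - x\<^sup>2)\<^sup>2 / 4\<close>; its maximum over the unit interval, taken near
  \<open>x = 0.66182\<close>, is \<open>1.48465751...\<close>.
\<close>

section \<open>Power series of functions on the unit disc\<close>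

lemma eventually_in_unit_disc:
  fixes z :: complex
  assumes "norm z < 1"
  shows "\<forall>\<^sub>F u in nhds z. norm u < 1"
  using eventually_nhds_in_open[of "ball 0 1" z] assms by simp

lemma fps_eq_if_eq_on_disc:
  fixes f g :: "complex \<Rightarrow> complex"
  assumes "f has_fps_expansion F" "g has_fps_expansion G" "\<And>z. norm z < 1 \<Longrightarrow> f z = g z"
  shows "F = G"
proof -
  have "\<forall>\<^sub>F z in nhds 0. f z = g z"
    using eventually_in_unit_disc[of 0] assms(3) by (auto elim!: eventually_mono)
  then have "fps_expansion f 0 = fps_expansion g 0"
    by (rule fps_expansion_cong)
  with assms(1,2) show ?thesis
    by (metis fps_expansion_eqI)
qed

lemma holomorphic_has_fps_expansion:
  assumes "f holomorphic_on ball 0 1"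
  shows "f has_fps_expansion fps_expansion f 0"
  using assms by (intro has_fps_expansion_fps_expansion[of "ball 0 1"]) auto

lemma has_fps_expansion_nth_0:
  fixes f :: "complex \<Rightarrow> complex"
  shows "f has_fps_expansion F \<Longrightarrow> fps_nth F 0 = f 0"
  by (simp add: fps_nth_fps_expansion)

section \<open>Coefficients of functions bounded by one\<close>

text \<open>
  The Schur class. The bound is not strict: the Schwarz quotient of a rotation is a unimodular
  constant, and the class has to be closed under this quotient.
\<close>

definition schur :: "(complex \<Rightarrow> complex) \<Rightarrow> bool" where
  "schur \<phi> \<longleftrightarrow> \<phi> holomorphic_on ball 0 1 \<and> (\<forall>z\<in>ball 0 1. norm (\<phi> z) \<le> 1)"

lemma schur_constant_if_norm_1:
  assumes "schur \<phi>" "norm w < 1" "norm (\<phi> w) = 1" "norm z < 1"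
  shows "\<phi> z = \<phi> w"
proof -
  have "\<phi> constant_on ball 0 1"
    using assms by (intro maximum_modulus_principle[of \<phi> "ball 0 1" "ball 0 1" w])
      (auto simp: schur_def)
  then show ?thesis
    using assms unfolding constant_on_def by (metis mem_ball_0)
qed

lemma schur_norm_less_1:
  assumes "schur \<phi>" "norm (\<phi> 0) < 1" "norm z < 1"
  shows "norm (\<phi> z) < 1"
  using schur_constant_if_norm_1[of \<phi> z 0] assms
  by (metis less_eq_real_def mem_ball_0 norm_zero schur_def zero_less_one)

text \<open>
  Schwarz's lemma in a form that can be iterated: the quotient stays in the Schur class.
\<close>

lemma schur_quotient:
  assumes "schur \<phi>" "\<phi> 0 = 0"
  obtains \<psi> where "schur \<psi>" "\<And>z. norm z < 1 \<Longrightarrow> \<phi> z = z * \<psi> z"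
proof -
  have hol: "\<phi> holomorphic_on ball 0 1"
    using assms by (simp add: schur_def)
  obtain h where h: "h holomorphic_on ball 0 1" "\<And>z. norm z < 1 \<Longrightarrow> \<phi> z = z * h z"
      "deriv \<phi> 0 = h 0"
    using Schwarz3[OF hol assms(2)] by auto
  have less: "norm (\<phi> z) < 1" if "norm z < 1" for z
    using schur_norm_less_1[OF assms(1) _ that] assms(2) by simp
  have "norm (h z) \<le> 1" if z: "norm z < 1" for z
  proof (cases "z = 0")
    case True
    then show ?thesis
      using Schwarz_Lemma(2)[OF hol assms(2) less z] h(3) by simp
  next
    case False
    have "norm z * norm (h z) \<le> norm z"
      using Schwarz_Lemma(1)[OF hol assms(2) less z] h(2)[OF z] by (simp add: norm_mult)
    then show ?thesis
      using False by simp
  qed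
  then have "schur h"
    using h(1) by (simp add: schur_def)
  then show thesis
    using h(2) that by blast
qed

text \<open>
  One step of Schur's algorithm. The Moebius transformation moving \<open>\<phi> 0\<close> to \<open>0\<close> makes the Schwarz
  quotient \<open>\<psi>\<close> available; the relation is cleared of denominators because it is then a polynomial
  identity between power series.
\<close>

lemma schur_step:
  assumes "schur \<phi>" "norm (\<phi> 0) < 1"
  obtains \<psi> where "schur \<psi>"
    "\<And>z. norm z < 1 \<Longrightarrow> \<phi> z = \<phi> 0 + z * \<psi> z * (1 - cnj (\<phi> 0) * \<phi> z)"
proof -
  define M where "M = Moebius_function 0 (\<phi> 0)"
  have lt: "norm (\<phi> z) < 1" if "norm z < 1" for z
    using schur_norm_less_1[OF assms that] .
  have "(M \<circ> \<phi>) holomorphic_on ball 0 1"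
    using assms lt unfolding M_def schur_def
    by (intro holomorphic_on_compose_gen[OF _ Moebius_function_holomorphic]) auto
  moreover have "norm ((M \<circ> \<phi>) z) \<le> 1" if "norm z < 1" for z
    using Moebius_function_norm_lt_1[OF assms(2) lt[OF that], of 0] by (simp add: M_def)
  ultimately have "schur (M \<circ> \<phi>)"
    by (simp add: schur_def)
  moreover have "(M \<circ> \<phi>) 0 = 0"
    by (simp add: M_def Moebius_function_simple)
  ultimately obtain \<psi> where \<psi>: "schur \<psi>" "\<And>z. norm z < 1 \<Longrightarrow> (M \<circ> \<phi>) z = z * \<psi> z"
    using schur_quotient by blast
  show thesis
  proof
    fix z :: complex assume z: "norm z < 1"
    have "norm (cnj (\<phi> 0) * \<phi> z) < 1 * 1"
      unfolding norm_mult using assms(2) lt[OF z] by (intro mult_strict_mono') auto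
    then have "1 - cnj (\<phi> 0) * \<phi> z \<noteq> 0"
      by force
    then show "\<phi> z = \<phi> 0 + z * \<psi> z * (1 - cnj (\<phi> 0) * \<phi> z)"
      using \<psi>(2)[OF z] by (simp add: M_def Moebius_function_simple field_simps)
  qed (fact \<psi>(1))
qed

text \<open>
  Comparing coefficients in the Schur step expresses the coefficients of \<open>\<phi>\<close> through those of \<open>\<psi>\<close>,
  one degree lower; bounds for \<open>\<psi>\<close> therefore pass to \<open>\<phi>\<close> with the degree raised by one.
\<close>

lemma schur_fps_step:
  fixes \<Phi> :: "complex fps"
  assumes "schur \<phi>" "\<phi> has_fps_expansion \<Phi>" "norm (fps_nth \<Phi> 0) < 1"
  obtains \<psi> and X :: "complex fps" where "schur \<psi>" "\<psi> has_fps_expansion X"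
    "fps_nth \<Phi> 1 = of_real (1 - (norm (fps_nth \<Phi> 0))\<^sup>2) * fps_nth X 0"
    "fps_nth \<Phi> 2 = of_real (1 - (norm (fps_nth \<Phi> 0))\<^sup>2)
       * (fps_nth X 1 - cnj (fps_nth \<Phi> 0) * (fps_nth X 0)\<^sup>2)"
proof -
  define e where "e = fps_nth \<Phi> 0"
  have e: "\<phi> 0 = e"
    using has_fps_expansion_nth_0[OF assms(2)] by (simp add: e_def)
  obtain \<psi> where \<psi>: "schur \<psi>" "\<And>z. norm z < 1 \<Longrightarrow> \<phi> z = e + z * \<psi> z * (1 - cnj e * \<phi> z)"
    using schur_step[of \<phi>] assms e e_def by metis
  define X where "X = fps_expansion \<psi> 0"
  have X: "\<psi> has_fps_expansion X"
    using \<psi>(1) holomorphic_has_fps_expansion by (simp add: X_def schur_def)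
  have eq: "\<Phi> = fps_const e + fps_X * X * (1 - fps_const (cnj e) * \<Phi>)"
    by (rule fps_eq_if_eq_on_disc[OF assms(2) _ \<psi>(2)]) (intro fps_expansion_intros X assms)
  have ee: "1 - e * cnj e = complex_of_real (1 - (norm e)\<^sup>2)"
    unfolding of_real_diff complex_norm_square by simp
  have 1: "fps_nth \<Phi> 1 = (1 - e * cnj e) * fps_nth X 0"
    by (subst eq) (simp add: fps_mult_nth mult.assoc e_def algebra_simps)
  have 2: "fps_nth \<Phi> 2 = fps_nth X 1 * (1 - e * cnj e) - fps_nth X 0 * cnj e * fps_nth \<Phi> 1"
    by (subst eq) (simp add: fps_mult_nth mult.assoc e_def numeral_2_eq_2 algebra_simps)
  have "fps_nth \<Phi> 2 = (1 - e * cnj e) * (fps_nth X 1 - cnj e * (fps_nth X 0)\<^sup>2)"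
    unfolding 2 1 by (simp add: power2_eq_square algebra_simps)
  with 1 show thesis
    using that[OF \<psi>(1) X] unfolding ee e_def[symmetric] by simp
qed

text \<open>
  The boundary case, in which the Schur step is not available: by the maximum principle \<open>\<phi>\<close> is
  constant.
\<close>

lemma schur_fps_const:
  assumes "schur \<phi>" "\<phi> has_fps_expansion \<Phi>" "norm (fps_nth \<Phi> 0) = 1"
  shows "\<Phi> = fps_const (fps_nth \<Phi> 0)"
proof (rule fps_eq_if_eq_on_disc[OF assms(2)])
  show "(\<lambda>_. fps_nth \<Phi> 0) has_fps_expansion fps_const (fps_nth \<Phi> 0)"
    by (rule has_fps_expansion_const)
  show "\<phi> z = fps_nth \<Phi> 0" if "norm z < 1" for z
    using schur_constant_if_norm_1[OF assms(1), of 0 z] assms(3) that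
    by (simp add: has_fps_expansion_nth_0[OF assms(2)])
qed

lemma schur_coeff_0:
  assumes "schur \<phi>" "\<phi> has_fps_expansion \<Phi>"
  shows "norm (fps_nth \<Phi> 0) \<le> 1"
  using assms has_fps_expansion_nth_0[OF assms(2)] by (simp add: schur_def)

lemma schur_coeff_1:
  assumes "schur \<phi>" "\<phi> has_fps_expansion \<Phi>"
  shows "norm (fps_nth \<Phi> 1) \<le> 1 - (norm (fps_nth \<Phi> 0))\<^sup>2"
proof (cases "norm (fps_nth \<Phi> 0) = 1")
  case True
  have "fps_nth \<Phi> 1 = 0"
    using arg_cong[OF schur_fps_const[OF assms True], of "\<lambda>A. fps_nth A 1"] by simp
  then show ?thesis
    by (simp add: True)
next
  case False
  then have lt: "norm (fps_nth \<Phi> 0) < 1"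
    using schur_coeff_0[OF assms] by simp
  obtain \<psi> X where \<psi>: "schur \<psi>" "\<psi> has_fps_expansion X"
    "fps_nth \<Phi> 1 = of_real (1 - (norm (fps_nth \<Phi> 0))\<^sup>2) * fps_nth X 0"
    using schur_fps_step[OF assms lt] by metis
  have nn: "0 \<le> 1 - (norm (fps_nth \<Phi> 0))\<^sup>2"
    using lt by (simp add: power_le_one)
  have "norm (fps_nth \<Phi> 1) = of_real (1 - (norm (fps_nth \<Phi> 0))\<^sup>2) * norm (fps_nth X 0)"
    unfolding \<psi>(3) norm_mult norm_of_real using nn by simp
  then show ?thesis
    using mult_left_mono[OF schur_coeff_0[OF \<psi>(1,2)] nn] by simp
qed

text \<open>
  The first-order bound for \<open>\<psi>\<close>, inserted in the formula for the second coefficient of \<open>\<phi>\<close>. The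
  subtracted square is essential for the general bound: it makes the linear term \<open>4 x y\<close> in the
  final estimate affordable.
\<close>

lemma schur_coeff_2:
  assumes "schur \<phi>" "\<phi> has_fps_expansion \<Phi>"
  shows "norm (fps_nth \<Phi> 2)
    \<le> 1 - (norm (fps_nth \<Phi> 0))\<^sup>2 - (norm (fps_nth \<Phi> 1))\<^sup>2 / (1 + norm (fps_nth \<Phi> 0))"
proof (cases "norm (fps_nth \<Phi> 0) = 1")
  case True
  have "fps_nth \<Phi> 1 = 0" "fps_nth \<Phi> 2 = 0"
    using arg_cong[OF schur_fps_const[OF assms True], of "\<lambda>A. fps_nth A 1"]
      arg_cong[OF schur_fps_const[OF assms True], of "\<lambda>A. fps_nth A 2"] by simp_all
  then show ?thesis
    by (simp add: True)
next
  case False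
  define x where "x = norm (fps_nth \<Phi> 0)"
  have x: "0 \<le> x" "x < 1"
    using False schur_coeff_0[OF assms] by (simp_all add: x_def)
  obtain \<psi> X where \<psi>: "schur \<psi>" "\<psi> has_fps_expansion X"
    "fps_nth \<Phi> 1 = of_real (1 - x\<^sup>2) * fps_nth X 0"
    "fps_nth \<Phi> 2 = of_real (1 - x\<^sup>2) * (fps_nth X 1 - cnj (fps_nth \<Phi> 0) * (fps_nth X 0)\<^sup>2)"
    using schur_fps_step[OF assms] x unfolding x_def by metis
  define d where "d = norm (fps_nth X 0)"
  have nn: "0 \<le> 1 - x\<^sup>2"
    using x by (simp add: power_le_one)
  have n1: "norm (fps_nth \<Phi> 1) = (1 - x\<^sup>2) * d"
    unfolding \<psi>(3) norm_mult norm_of_real using nn by (simp add: d_def)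
  have "norm (fps_nth \<Phi> 2) = (1 - x\<^sup>2) * norm (fps_nth X 1 - cnj (fps_nth \<Phi> 0) * (fps_nth X 0)\<^sup>2)"
    unfolding \<psi>(4) norm_mult norm_of_real using nn by simp
  also have "\<dots> \<le> (1 - x\<^sup>2) * ((1 - d\<^sup>2) + x * d\<^sup>2)"
    using schur_coeff_1[OF \<psi>(1,2)]
    by (intro mult_left_mono[OF _ nn] order.trans[OF norm_triangle_ineq4])
      (simp add: norm_mult norm_power d_def x_def)
  also have "\<dots> = 1 - x\<^sup>2 - ((1 - x\<^sup>2) * d)\<^sup>2 / (1 + x)"
    using x by (simp add: field_simps power2_eq_square)
  finally show ?thesis
    unfolding n1 x_def .
qed

section \<open>Jack's lemma\<close>

lemma real_ge_1_if_halfplane: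
  fixes l :: complex
  assumes "\<And>\<eta>. Re \<eta> > 0 \<Longrightarrow> Re \<eta> \<le> Re (\<eta> * l)"
  shows "Im l = 0" "Re l \<ge> 1"
proof -
  show "Im l = 0"
  proof (rule ccontr)
    assume "Im l \<noteq> 0"
    \<comment> \<open>The direction that cancels the real part of \<open>\<eta> l\<close>.\<close>
    then show False
      using assms[of "Complex 1 (Re l / Im l)"] by simp
  qed
  show "Re l \<ge> 1"
    using assms[of 1] by simp
qed

text \<open>
  Jack's lemma. By Schwarz's lemma \<open>|w(z\<^sub>0 u)| \<le> |u|\<close> in the unit disc, with equality at
  \<open>u = 1\<close>. Leaving \<open>1\<close> along \<open>u = 1 - t \<eta>\<close> with \<open>Re \<eta> > 0\<close>, the difference of the squared moduli
  cannot increase to first order. For \<open>l = z\<^sub>0 w'(z\<^sub>0) / w(z\<^sub>0)\<close> this says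
  \<open>Re \<eta> \<le> Re (\<eta> l)\<close> for every direction \<open>\<eta>\<close> pointing into the disc, hence \<open>l\<close> is real and at
  least \<open>1\<close>.
\<close>

lemma Jack_lemma:
  assumes hol: "w holomorphic_on ball 0 1" and w0: "w 0 = 0"
    and z0: "norm z0 < 1" "norm (w z0) = 1"
    and inside: "\<And>z. norm z < norm z0 \<Longrightarrow> norm (w z) < 1"
  obtains k where "k \<ge> 1" "z0 * deriv w z0 = of_real k * w z0"
proof -
  define r where "r = norm z0"
  have r: "r > 0" "r < 1"
    using z0 w0 by (auto simp: r_def)
  have wz0: "w z0 \<noteq> 0"
    using z0 w0 by auto
  have schwarz: "norm (w (z0 * u)) \<le> norm u" if "norm u < 1" for u
  proof (rule Schwarz_Lemma(1)[of "\<lambda>u. w (z0 * u)"])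
    have "norm (z0 * v) < 1" if "norm v < 1" for v
      using mult_strict_mono'[of r 1 "norm v" 1] r that by (simp add: r_def norm_mult)
    then have "(w \<circ> (\<lambda>u. z0 * u)) holomorphic_on ball 0 1"
      by (intro holomorphic_on_compose_gen[OF _ hol] holomorphic_intros) auto
    then show "(\<lambda>u. w (z0 * u)) holomorphic_on ball 0 1"
      by (simp add: o_def)
    show "norm (w (z0 * v)) < 1" if "norm v < 1" for v
      using that r by (intro inside) (simp add: norm_mult r_def[symmetric])
  qed (use w0 that in auto)
  define l where "l = z0 * deriv w z0 / w z0"
  have der: "(w has_field_derivative deriv w z0) (at z0)"
    using hol z0 by (intro holomorphic_derivI[of w "ball 0 1"]) auto
  have "Re \<eta> \<le> Re (\<eta> * l)" if eta: "Re \<eta> > 0" for \<eta>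
  proof (rule ccontr)
    assume neg: "\<not> ?thesis"
    define v where "v t = w (z0 * (1 - of_real t * \<eta>))" for t :: real
    define F where "F t = (norm (v t))\<^sup>2 - (norm (1 - of_real t * \<eta>))\<^sup>2" for t :: real
    have dv: "(v has_vector_derivative (- (\<eta> * (z0 * deriv w z0)))) (at 0)"
    proof -
      have "((\<lambda>t. z0 * (1 - t * \<eta>)) has_field_derivative (- (z0 * \<eta>))) (at 0)"
        by (auto intro!: derivative_eq_intros)
      then have "((\<lambda>t. w (z0 * (1 - t * \<eta>))) has_field_derivative deriv w z0 * (- (z0 * \<eta>))) (at (of_real 0))"
        using der by (intro DERIV_chain2[of w]) auto
      from has_vector_derivative_real_field[OF this] show ?thesis
        unfolding v_def by (simp add: mult_ac)
    qed
    have du: "((\<lambda>t. 1 - of_real t * \<eta>) has_vector_derivative (- \<eta>)) (at 0)"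
    proof -
      have "((\<lambda>t. 1 - t * \<eta>) has_field_derivative (- \<eta>)) (at (of_real 0))"
        by (auto intro!: derivative_eq_intros)
      from has_vector_derivative_real_field[OF this] show ?thesis by simp
    qed
    have dn: "((\<lambda>t. (norm (g t))\<^sup>2) has_real_derivative 2 * Re (cnj (g 0) * d)) (at 0)"
      if "(g has_vector_derivative d) (at 0)" for g :: "real \<Rightarrow> complex" and d
    proof -
      have re: "((\<lambda>t. Re (g t)) has_real_derivative Re d) (at 0)"
        and im: "((\<lambda>t. Im (g t)) has_real_derivative Im d) (at 0)"
        using that has_vector_derivative_complex_iff by blast+
      have "((\<lambda>t. (Re (g t))\<^sup>2 + (Im (g t))\<^sup>2) has_real_derivative 2 * Re (cnj (g 0) * d)) (at 0)"
        using DERIV_add[OF DERIV_power[OF re, of 2] DERIV_power[OF im, of 2]]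
        by (simp add: algebra_simps)
      then show ?thesis
        by (simp add: cmod_power2)
    qed
    have v0: "v 0 = w z0"
      by (simp add: v_def)
    have "z0 * deriv w z0 = l * w z0"
      using wz0 by (simp add: l_def)
    then have "cnj (w z0) * (- (\<eta> * (z0 * deriv w z0))) = - (\<eta> * l * (w z0 * cnj (w z0)))"
      by (simp add: mult_ac)
    also have "\<dots> = - (\<eta> * l)"
      using z0(2) by (simp add: complex_norm_square[symmetric])
    finally have cl: "cnj (v 0) * (- (\<eta> * (z0 * deriv w z0))) = - (\<eta> * l)"
      unfolding v0 .
    have "(F has_real_derivative (2 * Re (- (\<eta> * l)) - 2 * Re (- \<eta>))) (at 0)"
      unfolding F_def using DERIV_diff[OF dn[OF dv] dn[OF du]] unfolding cl by simp
    then have dF: "(F has_real_derivative 2 * (Re \<eta> - Re (\<eta> * l))) (at 0)"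
      by (rule back_subst[of "\<lambda>D. (F has_real_derivative D) (at 0)"]) simp
    obtain d where d: "d > 0" "\<And>h. 0 < h \<Longrightarrow> h < d \<Longrightarrow> F 0 < F h"
      using DERIV_pos_inc_right[OF dF] neg by auto
    \<comment> \<open>The second bound keeps \<open>1 - h \<eta>\<close> in the unit disc: its squared modulus is
      \<open>1 - 2 h Re \<eta> + h\<^sup>2 |\<eta>|\<^sup>2\<close>.\<close>
    define h where "h = min (d / 2) (Re \<eta> / (norm \<eta>)\<^sup>2)"
    have enz: "\<eta> \<noteq> 0"
      using eta by auto
    have h: "0 < h" "h < d" "h * (norm \<eta>)\<^sup>2 \<le> Re \<eta>"
      using d(1) eta enz by (auto simp: h_def min_def field_simps)
    have "(norm (1 - of_real h * \<eta>))\<^sup>2 = 1 - h * (2 * Re \<eta> - h * (norm \<eta>)\<^sup>2)"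
      unfolding cmod_power2 by (simp add: power2_eq_square algebra_simps)
    also have "\<dots> < 1"
      using h eta by simp
    finally have "norm (1 - of_real h * \<eta>) < 1"
      by (simp add: power_less_one_iff abs_square_less_1)
    then have "norm (v h) \<le> norm (1 - of_real h * \<eta>)"
      unfolding v_def by (rule schwarz)
    then have "F h \<le> 0"
      by (simp add: F_def power_mono)
    moreover have "F 0 = 0"
      using z0(2) by (simp add: F_def v0)
    ultimately show False
      using d(2)[OF h(1,2)] by simp
  qed
  from real_ge_1_if_halfplane[OF this] have "l = of_real (Re l)" "Re l \<ge> 1"
    by (auto simp: complex_eq_iff)
  moreover have "z0 * deriv w z0 = l * w z0"
    using wz0 by (simp add: l_def)
  ultimately show thesis
    using that[of "Re l"] by metis
qed

text \<open>
  The form in which Jack's lemma is applied: if \<open>|w|\<close> reached \<open>1\<close>, it would do so first at a point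
  of smallest modulus, and there the conclusion of Jack's lemma would hold.
\<close>

lemma norm_less_1_if_no_Jack_point:
  assumes hol: "w holomorphic_on ball 0 1" and w0: "w 0 = 0"
    and no: "\<And>z k. norm z < 1 \<Longrightarrow> norm (w z) = 1 \<Longrightarrow> k \<ge> 1 \<Longrightarrow> z * deriv w z \<noteq> of_real k * w z"
    and z: "norm z < 1"
  shows "norm (w z) < 1"
proof (rule ccontr)
  assume neg: "\<not> ?thesis"
  define K where "K = cball 0 (norm z) \<inter> (\<lambda>u. norm (w u)) -` {1..}"
  have "continuous_on (cball 0 (norm z)) (\<lambda>u. norm (w u))"
    using z by (intro continuous_on_norm holomorphic_on_imp_continuous_on holomorphic_on_subset[OF hol]) auto
  then have "closed K"
    unfolding K_def by (rule continuous_closed_preimage) auto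
  then have "compact K"
    unfolding compact_eq_bounded_closed
    using bounded_subset[OF bounded_cball[of 0 "norm z"], of K] by (simp add: K_def)
  moreover have "z \<in> K"
    using neg by (simp add: K_def)
  ultimately obtain z0 where z0: "z0 \<in> K" "\<And>u. u \<in> K \<Longrightarrow> norm z0 \<le> norm u"
    using continuous_attains_inf[of K norm] by (auto intro: continuous_intros)
  have z01: "norm z0 \<le> norm z" "norm (w z0) \<ge> 1"
    using z0(1) by (auto simp: K_def)
  have inside: "norm (w u) < 1" if "norm u < norm z0" for u
    using z0(2)[of u] that z01 by (force simp: K_def)
  \<comment> \<open>Approaching \<open>z0\<close> along the radius, from points where \<open>|w| < 1\<close>.\<close>
  have "norm (w z0) \<le> 1"
  proof (rule ccontr)
    assume gt: "\<not> ?thesis"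
    have nz: "z0 \<noteq> 0"
      using gt w0 by auto
    have "((\<lambda>t. norm (w (of_real t * z0))) \<longlongrightarrow> norm (w (of_real 1 * z0))) (at_left 1)"
    proof -
      have "isCont w z0"
        using holomorphic_on_imp_continuous_on[OF hol] z z01(1)
        by (simp add: continuous_on_eq_continuous_at)
      have "isCont (\<lambda>t. norm (w (of_real t * z0))) 1"
      proof (intro isCont_norm isCont_o2[of 1 "\<lambda>t. of_real t * z0" w])
        show "isCont (\<lambda>t. of_real t * z0) 1"
          by (intro continuous_intros)
      qed (use \<open>isCont w z0\<close> in simp)
      then show ?thesis
        unfolding isCont_def by (rule filterlim_at_split[THEN iffD1, THEN conjunct1])
    qed
    moreover have "\<forall>\<^sub>F t in at_left 1. norm (w (of_real t * z0)) \<le> 1"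
      unfolding eventually_at_left_field
      by (rule exI[of _ 0]) (use nz in \<open>auto intro!: less_imp_le inside simp: norm_mult\<close>)
    ultimately have "norm (w (of_real 1 * z0)) \<le> 1"
      by (intro tendsto_upperbound[where F = "at_left (1::real)"]) auto
    with gt show False by simp
  qed
  then have "norm (w z0) = 1"
    using z01 by simp
  moreover have "norm z0 < 1"
    using z z01 by simp
  ultimately show False
    using Jack_lemma[OF hol w0, of z0] inside no by metis
qed

section \<open>The quotient of z by a function of the class\<close>

lemma class_U_z_over:
  assumes "f \<in> class_U"
  shows "z_over f holomorphic_on ball 0 1"
    and "\<And>z. norm z < 1 \<Longrightarrow> z_over f z \<noteq> 0"
    and "\<And>z. norm z < 1 \<Longrightarrow> z_over f z * f z = z"
proof -
  have f: "f holomorphic_on ball 0 1" "f 0 = 0" "deriv f 0 = 1"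
      "\<And>z. norm z < 1 \<Longrightarrow> z \<noteq> 0 \<Longrightarrow> f z \<noteq> 0"
    using assms by (auto simp: class_U_def class_A_def)
  obtain h where h: "h holomorphic_on ball 0 1" "\<And>z. norm z < 1 \<Longrightarrow> f z = z * h z" "h 0 = 1"
    using Schwarz3[OF f(1,2)] f(3) by metis
  have nz: "h z \<noteq> 0" if "norm z < 1" for z
    using f(4)[OF that] h(2)[OF that] h(3) by (cases "z = 0") auto
  have eq: "z_over f z = 1 / h z" if "norm z < 1" for z
    using h(2)[OF that] h(3) nz[OF that] by (auto simp: z_over_def)
  have "(\<lambda>z. 1 / h z) holomorphic_on ball 0 1"
    using nz by (intro holomorphic_intros h) auto
  then show "z_over f holomorphic_on ball 0 1"
    by (rule holomorphic_transform) (simp add: eq)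
  show "z_over f z \<noteq> 0" "z_over f z * f z = z" if "norm z < 1" for z
    using eq[OF that] nz[OF that] h(2)[OF that] by auto
qed

text \<open>
  The defining expression of the class in terms of \<open>p = z / f\<close>: differentiating \<open>f = z / p\<close>
  gives \<open>p\<^sup>2 f' = p - z p'\<close>, which is linear in \<open>p\<close>.
\<close>

lemma class_U_condition:
  assumes "f \<in> class_U" and z: "norm z < 1"
  shows "norm (z_over f z - z * deriv (z_over f) z - 1) < 1"
proof -
  define p where "p = z_over f"
  note p = class_U_z_over[OF assms(1), folded p_def]
  have "((\<lambda>u. u / p u) has_field_derivative (p z - z * deriv p z) / (p z)\<^sup>2) (at z)"
    using z p(2)[OF z] by (auto intro!: derivative_eq_intros holomorphic_derivI[OF p(1)]
        simp: power2_eq_square)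
  moreover have "\<forall>\<^sub>F u in nhds z. u / p u = f u"
    using eventually_in_unit_disc[OF z] by eventually_elim (use p(2,3) in \<open>auto simp: field_simps\<close>)
  ultimately have "deriv f z = (p z - z * deriv p z) / (p z)\<^sup>2"
    using DERIV_imp_deriv deriv_cong_ev by metis
  then have "(p z)\<^sup>2 * deriv f z = p z - z * deriv p z"
    using p(2)[OF z] by simp
  moreover have "norm ((p z)\<^sup>2 * deriv f z - 1) < 1"
    using assms by (simp add: class_U_def p_def)
  ultimately show ?thesis
    by (simp add: p_def)
qed

text \<open>
  If \<open>|w|\<close> reached \<open>1\<close>, Jack's lemma would apply at some point with a factor \<open>k\<close>, and there
  \<open>p - z p' - 1 = - w ((2 k - 2) + (2 k - 1) w)\<close>, whose modulus is at least
  \<open>(2 k - 1) - (2 k - 2) = 1\<close>. The result is a subordination to \<open>(1 + z)\<^sup>2\<close>, which is the value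
  of \<open>z / f\<close> for the Koebe function \<open>z / (1 + z)\<^sup>2\<close>.
\<close>

lemma class_U_sqrt:
  assumes "f \<in> class_U"
  obtains w where "w holomorphic_on ball 0 1" "w 0 = 0"
    "\<And>z. norm z < 1 \<Longrightarrow> norm (w z) < 1"
    "\<And>z. norm z < 1 \<Longrightarrow> z_over f z = (1 + w z)\<^sup>2"
proof -
  define p where "p = z_over f"
  note p = class_U_z_over[OF assms(1), folded p_def]
  have p0: "p 0 = 1"
    by (simp add: p_def z_over_def)
  obtain q where q: "q holomorphic_on ball 0 1" "\<And>z. z \<in> ball 0 1 \<Longrightarrow> p z = (q z)\<^sup>2"
    using contractible_imp_holomorphic_sqrt[OF p(1)] p(2) by (auto simp: convex_imp_contractible)
  \<comment> \<open>Choose the branch of the square root with value 1 at the origin.\<close>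
  define w where "w z = q z / q 0 - 1" for z
  have q0: "(q 0)\<^sup>2 = 1"
    using q(2)[of 0] p0 by simp
  have hol: "w holomorphic_on ball 0 1"
    unfolding w_def using q0 by (intro holomorphic_intros q) auto
  have w0: "w 0 = 0"
    using q0 by (auto simp: w_def)
  have pw: "p z = (1 + w z)\<^sup>2" if "norm z < 1" for z
    using q(2)[of z] that q0 by (simp add: w_def power_divide)
  have "norm (w z) < 1" if z: "norm z < 1" for z
  proof (rule norm_less_1_if_no_Jack_point[OF hol w0 _ z])
    fix z :: complex and k :: real
    assume z: "norm z < 1" and w: "norm (w z) = 1" and k: "k \<ge> 1"
    show "z * deriv w z \<noteq> of_real k * w z"
    proof
      assume Jack: "z * deriv w z = of_real k * w z"
      have "((\<lambda>u. (1 + w u)\<^sup>2) has_field_derivative 2 * (1 + w z) * deriv w z) (at z)"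
        using z by (auto intro!: derivative_eq_intros holomorphic_derivI[OF hol])
      moreover have "\<forall>\<^sub>F u in nhds z. (1 + w u)\<^sup>2 = p u"
        using eventually_in_unit_disc[OF z] by eventually_elim (use pw in auto)
      ultimately have "deriv p z = 2 * (1 + w z) * deriv w z"
        using DERIV_imp_deriv deriv_cong_ev by metis
      then have "p z - z * deriv p z - 1 = (1 + w z)\<^sup>2 - 2 * (1 + w z) * (z * deriv w z) - 1"
        using pw[OF z] by (simp add: mult_ac)
      also have "\<dots> = - (w z * (of_real (2 * k - 2) + of_real (2 * k - 1) * w z))"
        unfolding Jack by (simp add: power2_eq_square algebra_simps)
      finally have "norm (of_real (2 * k - 2) + of_real (2 * k - 1) * w z) < 1"
        using class_U_condition[OF assms z] w by (simp add: p_def[symmetric] norm_mult)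
      moreover have "norm (of_real (2 * k - 1) * w z) - norm (of_real (2 * k - 2) :: complex)
          \<le> norm (of_real (2 * k - 2) + of_real (2 * k - 1) * w z)"
        by (metis add.commute norm_diff_ineq)
      ultimately show False
        using w k unfolding norm_mult norm_of_real by simp
    qed
  qed
  then show thesis
    using that hol w0 pw unfolding p_def by blast
qed

text \<open>
  The function \<open>\<phi>\<close> is \<open>(p - z p' - 1) / z\<^sup>2\<close>, obtained by two Schwarz quotients; since
  \<open>X\<^sup>n\<close> goes to \<open>(1 - n) X\<^sup>n\<close> under \<open>P - X P'\<close>, its coefficients are multiples of those of \<open>p\<close>. The
  relation \<open>p f = z\<close> then yields the coefficients of \<open>f\<close>. If \<open>W\<^sub>0, W\<^sub>1\<close> are the first coefficients
  of \<open>w / z\<close> for \<open>p = (1 + w)\<^sup>2\<close>, then \<open>a\<^sub>2 = - 2 W\<^sub>0\<close> and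
  \<open>a\<^sub>3 = 3 W\<^sub>0\<^sup>2 - 2 W\<^sub>1\<close>, so \<open>|W\<^sub>1| \<le> 1 - |W\<^sub>0|\<^sup>2\<close> gives the last two bounds.
\<close>

lemma class_U_coeffs:
  assumes "f \<in> class_U"
  obtains \<phi> \<Phi> where "schur \<phi>" "\<phi> has_fps_expansion \<Phi>"
    "taylor_coeff f 3 = (taylor_coeff f 2)\<^sup>2 + fps_nth \<Phi> 0"
    "taylor_coeff f 4 = taylor_coeff f 2 ^ 3 + 2 * taylor_coeff f 2 * fps_nth \<Phi> 0 + fps_nth \<Phi> 1 / 2"
    "taylor_coeff f 5 = taylor_coeff f 2 ^ 4 + 3 * (taylor_coeff f 2)\<^sup>2 * fps_nth \<Phi> 0
       + taylor_coeff f 2 * fps_nth \<Phi> 1 + (fps_nth \<Phi> 0)\<^sup>2 + fps_nth \<Phi> 2 / 3"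
    "norm (taylor_coeff f 2) \<le> 2" "norm (taylor_coeff f 3) \<le> 3"
proof -
  define p where "p = z_over f"
  note p = class_U_z_over[OF assms(1), folded p_def]
  define F where "F = fps_expansion f 0"
  define P where "P = fps_expansion p 0"
  have f: "f holomorphic_on ball 0 1" "f 0 = 0" "deriv f 0 = 1"
    using assms by (auto simp: class_U_def class_A_def)
  have F: "f has_fps_expansion F" and P: "p has_fps_expansion P"
    unfolding F_def P_def using f(1) p(1) by (simp_all add: holomorphic_has_fps_expansion)
  have F01: "fps_nth F 0 = 0" "fps_nth F (Suc 0) = 1"
    using f by (simp_all add: fps_nth_fps_expansion[OF F])
  have P0: "fps_nth P 0 = 1"
    using has_fps_expansion_nth_0[OF P] by (simp add: p_def z_over_def)

  define \<psi> where "\<psi> z = p z - z * deriv p z - 1" for z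
  define \<Psi> where "\<Psi> = P - fps_X * fps_deriv P - 1"
  have \<Psi>: "\<psi> has_fps_expansion \<Psi>"
    unfolding \<psi>_def[abs_def] \<Psi>_def by (intro fps_expansion_intros P)
  have "schur \<psi>"
    unfolding schur_def
  proof
    show "\<psi> holomorphic_on ball 0 1"
      unfolding \<psi>_def[abs_def] by (intro holomorphic_intros p(1)) auto
    show "\<forall>z\<in>ball 0 1. norm (\<psi> z) \<le> 1"
      using class_U_condition[OF assms] by (auto simp: \<psi>_def p_def less_imp_le)
  qed
  moreover have "\<psi> 0 = 0"
    by (simp add: \<psi>_def p_def z_over_def)
  ultimately obtain \<psi>1 where \<psi>1: "schur \<psi>1" "\<And>z. norm z < 1 \<Longrightarrow> \<psi> z = z * \<psi>1 z"
    using schur_quotient by blast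
  define \<Psi>1 where "\<Psi>1 = fps_expansion \<psi>1 0"
  have \<Psi>1: "\<psi>1 has_fps_expansion \<Psi>1"
    using \<psi>1(1) holomorphic_has_fps_expansion by (simp add: \<Psi>1_def schur_def)
  have eq1: "\<Psi> = fps_X * \<Psi>1"
    by (rule fps_eq_if_eq_on_disc[OF \<Psi> _ \<psi>1(2)]) (intro fps_expansion_intros \<Psi>1)
  \<comment> \<open>The linear terms of \<open>P\<close> and \<open>X P'\<close> cancel, so a second quotient is possible.\<close>
  have "\<psi>1 0 = fps_nth \<Psi> 1"
    using has_fps_expansion_nth_0[OF \<Psi>1] by (simp add: eq1)
  also have "\<dots> = 0"
    by (simp add: \<Psi>_def)
  finally obtain \<phi> where \<phi>: "schur \<phi>" "\<And>z. norm z < 1 \<Longrightarrow> \<psi>1 z = z * \<phi> z"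
    using schur_quotient \<psi>1(1) by blast
  define \<Phi> where "\<Phi> = fps_expansion \<phi> 0"
  have \<Phi>: "\<phi> has_fps_expansion \<Phi>"
    using \<phi>(1) holomorphic_has_fps_expansion by (simp add: \<Phi>_def schur_def)
  have "\<Psi>1 = fps_X * \<Phi>"
    by (rule fps_eq_if_eq_on_disc[OF \<Psi>1 _ \<phi>(2)]) (intro fps_expansion_intros \<Phi>)
  with eq1 have eq2: "\<Psi> = fps_X * (fps_X * \<Phi>)"
    by simp
  have "fps_nth \<Phi> 0 = - fps_nth P 2" "fps_nth \<Phi> 1 = - (2 * fps_nth P 3)"
      "fps_nth \<Phi> 2 = - (3 * fps_nth P 4)"
    using arg_cong[OF eq2, of "\<lambda>A. fps_nth A 2"] arg_cong[OF eq2, of "\<lambda>A. fps_nth A 3"]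
      arg_cong[OF eq2, of "\<lambda>A. fps_nth A 4"]
    by (simp_all add: \<Psi>_def algebra_simps numeral_eq_Suc)
  then have P\<Phi>: "fps_nth P 2 = - fps_nth \<Phi> 0" "fps_nth P 3 = - fps_nth \<Phi> 1 / 2"
      "fps_nth P 4 = - fps_nth \<Phi> 2 / 3"
    by simp_all

  have PF: "P * F = fps_X"
    by (rule fps_eq_if_eq_on_disc[OF _ _ p(3)]) (use P F in \<open>auto intro: fps_expansion_intros\<close>)
  have rel: "fps_nth P 1 = - fps_nth F 2"
    "fps_nth F 3 = - (fps_nth P 1 * fps_nth F 2 + fps_nth P 2)"
    "fps_nth F 4 = - (fps_nth P 1 * fps_nth F 3 + fps_nth P 2 * fps_nth F 2 + fps_nth P 3)"
    "fps_nth F 5 = - (fps_nth P 1 * fps_nth F 4 + fps_nth P 2 * fps_nth F 3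
       + fps_nth P 3 * fps_nth F 2 + fps_nth P 4)"
    unfolding eq_neg_iff_add_eq_0
    using arg_cong[OF PF, of "\<lambda>A. fps_nth A 2"] arg_cong[OF PF, of "\<lambda>A. fps_nth A 3"]
      arg_cong[OF PF, of "\<lambda>A. fps_nth A 4"] arg_cong[OF PF, of "\<lambda>A. fps_nth A 5"]
    by (simp_all add: fps_mult_nth numeral_eq_Suc F01 P0 add_ac mult_ac)

  obtain w where w: "w holomorphic_on ball 0 1" "w 0 = 0" "\<And>z. norm z < 1 \<Longrightarrow> norm (w z) < 1"
      "\<And>z. norm z < 1 \<Longrightarrow> p z = (1 + w z)\<^sup>2"
    using class_U_sqrt[OF assms] unfolding p_def by metis
  have "schur w"
    using w(1,3) by (simp add: schur_def less_imp_le)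
  then obtain \<omega> where \<omega>: "schur \<omega>" "\<And>z. norm z < 1 \<Longrightarrow> w z = z * \<omega> z"
    using schur_quotient w(2) by blast
  define W where "W = fps_expansion \<omega> 0"
  have W: "\<omega> has_fps_expansion W"
    using \<omega>(1) holomorphic_has_fps_expansion by (simp add: W_def schur_def)
  have "P = (1 + fps_X * W)\<^sup>2"
    by (rule fps_eq_if_eq_on_disc[OF P]) (auto intro!: fps_expansion_intros W simp: \<omega>(2) w(4))
  then have PW: "fps_nth P 1 = 2 * fps_nth W 0"
      "fps_nth P 2 = (fps_nth W 0)\<^sup>2 + 2 * fps_nth W 1"
    by (simp_all add: power2_eq_square fps_mult_nth numeral_eq_Suc)
  have W0: "norm (fps_nth W 0) \<le> 1" and W1: "norm (fps_nth W 1) \<le> 1 - (norm (fps_nth W 0))\<^sup>2"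
    using schur_coeff_0[OF \<omega>(1) W] schur_coeff_1[OF \<omega>(1) W] by auto
  have F2: "fps_nth F 2 = - 2 * fps_nth W 0"
    using rel(1) PW(1) by (metis minus_equation_iff mult_minus_left)
  have F3: "fps_nth F 3 = 3 * (fps_nth W 0)\<^sup>2 - 2 * fps_nth W 1"
    unfolding rel(2) F2 PW by (simp add: power2_eq_square algebra_simps)
  have "norm (fps_nth F 3) \<le> 3 * (norm (fps_nth W 0))\<^sup>2 + 2 * norm (fps_nth W 1)"
    unfolding F3 by (rule order.trans[OF norm_triangle_ineq4]) (simp add: norm_mult norm_power)
  also have "\<dots> \<le> 3"
    using W1 power_le_one[OF norm_ge_zero W0, of 2] by simp
  finally have "norm (fps_nth F 3) \<le> 3" .
  moreover have "norm (fps_nth F 2) \<le> 2"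
    using W0 by (simp add: F2 norm_mult)
  moreover have "taylor_coeff f = fps_nth F"
    by (simp add: taylor_coeff_def[abs_def] F_def)
  ultimately show thesis
    using that[OF \<phi>(1) \<Phi>] rel unfolding P\<Phi>
    by (simp add: power2_eq_square power3_eq_cube power4_eq_xxxx algebra_simps)
qed

section \<open>Extremal problems in two real variables\<close>

text \<open>
  The form of the determinant when \<open>a\<^sub>2 = 0\<close>. Dropping \<open>4 y\<^sup>2 / (1 + x)\<close> and taking \<open>y\<close> maximal leaves a
  polynomial in \<open>x\<close> with value \<open>1\<close> at \<open>x = 1\<close>, and the factor \<open>1 - x\<close> splits off from the defect.
\<close>

lemma bound_a2_zero:
  fixes x y u :: real
  assumes "0 \<le> x" "x \<le> 1" "0 \<le> y" "y \<le> (1 - x\<^sup>2) / 2" "u \<le> (1 - x\<^sup>2 - 4 * y\<^sup>2 / (1 + x)) / 3"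
  shows "x * u + x ^ 3 + y\<^sup>2 \<le> 1"
proof -
  have "x * u \<le> x * ((1 - x\<^sup>2) / 3)"
    using assms by (intro mult_left_mono order.trans[OF assms(5)]) auto
  moreover have "y\<^sup>2 \<le> ((1 - x\<^sup>2) / 2)\<^sup>2"
    using assms by (intro power_mono) auto
  moreover have "x * ((1 - x\<^sup>2) / 3) + x ^ 3 + ((1 - x\<^sup>2) / 2)\<^sup>2 \<le> 1"
  proof -
    have "1 - (x * ((1 - x\<^sup>2) / 3) + x ^ 3 + ((1 - x\<^sup>2) / 2)\<^sup>2)
      = (1 - x) * (9 + 5 * x + 11 * x\<^sup>2 + 3 * x ^ 3) / 12"
      by (simp add: power2_eq_square power3_eq_cube field_simps)
    also have "\<dots> \<ge> 0"
      using assms by simp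
    finally show ?thesis by simp
  qed
  ultimately show ?thesis by linarith
qed

text \<open>
  After inserting the bound on \<open>u\<close>, the expression is a concave quadratic in \<open>y\<close>. For small \<open>x\<close> its
  unconstrained maximum is far below the constant. For larger \<open>x\<close> it increases up to the endpoint
  \<open>s = (1 - x\<^sup>2) / 2\<close>, where it becomes \<open>3 x - 2 x\<^sup>3 + (1 - x\<^sup>2)\<^sup>2 / 4\<close>. That the vertex
  passes the endpoint means \<open>(3 - x) (1 - x) \<le> 4 x\<close>, which holds from \<open>4 - sqrt 13 = 0.394...\<close> on;
  the case distinction is therefore made at \<open>2 / 5\<close>.
\<close>

lemma bound_general:
  fixes x y u :: real
  assumes x: "0 \<le> x" "x \<le> 1" and y: "0 \<le> y" "y \<le> (1 - x\<^sup>2) / 2"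
    and u: "u \<le> (1 - x\<^sup>2 - 4 * y\<^sup>2 / (1 + x)) / 3"
  shows "3 * u + 4 * x * y + x ^ 3 + y\<^sup>2 \<le> 1.48465755"
proof -
  have ux: "3 * u \<le> 1 - x\<^sup>2 - 4 * y\<^sup>2 / (1 + x)"
    using u by simp
  show ?thesis
  proof (cases "x \<le> 2 / 5")
    case True
    \<comment> \<open>Here \<open>13 / 7 = 4 / (7 / 5) - 1\<close>, and the square completed below has its vertex at \<open>14 x / 13\<close>.\<close>
    have "4 * y\<^sup>2 / (1 + x) \<ge> 4 * y\<^sup>2 / (7 / 5)"
      using True x by (intro divide_left_mono) auto
    then have "3 * u + 4 * x * y + x ^ 3 + y\<^sup>2 \<le> 1 - x\<^sup>2 + x ^ 3 + 4 * x * y - 13 / 7 * y\<^sup>2"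
      using ux by simp
    also have "\<dots> \<le> 1 - x\<^sup>2 + x ^ 3 + 28 / 13 * x\<^sup>2"
      using zero_le_power2[of "y - 14 / 13 * x"] by (simp add: power2_eq_square algebra_simps)
    also have "\<dots> \<le> 1 + 21 / 13 * x\<^sup>2"
    proof -
      have "x ^ 3 \<le> 2 / 5 * x\<^sup>2"
        using mult_right_mono[OF True, of "x\<^sup>2"] by (simp add: power2_eq_square power3_eq_cube)
      then show ?thesis
        using zero_le_power2[of x] by linarith
    qed
    also have "\<dots> \<le> 1 + 21 / 13 * (2 / 5)\<^sup>2"
      using True x by (intro add_left_mono mult_left_mono power_mono) auto
    finally show ?thesis by (simp add: power2_eq_square)
  next
    case False
    define s where "s = (1 - x\<^sup>2) / 2"
    have ys: "y \<le> s"
      using y by (simp add: s_def)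
    define r where "r = (3 - x) / (1 + x)"
    have r: "4 / (1 + x) = r + 1" and rs: "r * s = (3 - x) * (1 - x) / 2" and r0: "0 \<le> r"
      using x by (simp_all add: r_def s_def field_simps power2_eq_square)
    have "(3 - x) * (1 - x) \<le> 4 * x"
    proof -
      have "0 \<le> (x - 2 / 5) * (8 - x - 2 / 5)"
        using False x by (intro mult_nonneg_nonneg) auto
      then show ?thesis by (simp add: field_simps)
    qed
    then have "r * (y + s) \<le> 4 * x"
      using mult_left_mono[OF ys r0] rs by (simp add: algebra_simps)
    then have "0 \<le> (s - y) * (4 * x - r * (y + s))"
      using ys by (intro mult_nonneg_nonneg) auto
    then have mono: "4 * x * y - r * y\<^sup>2 \<le> 4 * x * s - r * s\<^sup>2"
      by (simp add: power2_eq_square algebra_simps)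
    have "4 * y\<^sup>2 / (1 + x) = (r + 1) * y\<^sup>2"
      unfolding r[symmetric] by simp
    then have "3 * u + 4 * x * y + x ^ 3 + y\<^sup>2 \<le> 1 - x\<^sup>2 + x ^ 3 + (4 * x * s - r * s\<^sup>2)"
      using ux mono by (simp add: algebra_simps)
    also have "r * s\<^sup>2 = (3 - x) * (1 - x) / 2 * s"
      using rs by (simp add: power2_eq_square)
    also have "1 - x\<^sup>2 + x ^ 3 + (4 * x * s - (3 - x) * (1 - x) / 2 * s)
      = 3 * x - 2 * x ^ 3 + (1 - x\<^sup>2)\<^sup>2 / 4"
      by (simp add: s_def power2_eq_square power3_eq_cube field_simps)
    also have "\<dots> \<le> 1.48465755"
    proof -
      \<comment> \<open>Second-order expansion at a point \<open>a\<close> close to the maximum, with exact remainder \<open>q\<close>. The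
        slope \<open>d\<close> at \<open>a\<close> is about \<open>0.00003\<close>, so its contribution is absorbed by the square.\<close>
      define a :: real where "a = 0.66182"
      define q where "q = 1 / 2 + 2 * (x + 2 * a) - (x\<^sup>2 + 2 * a * x + 3 * a\<^sup>2) / 4"
      define d where "d = 3 - a - 6 * a\<^sup>2 + a ^ 3"
      have "3 * x - 2 * x ^ 3 + (1 - x\<^sup>2)\<^sup>2 / 4
        = (3 * a - 2 * a ^ 3 + (1 - a\<^sup>2)\<^sup>2 / 4) + d * (x - a) - q * (x - a)\<^sup>2"
        by (simp add: q_def d_def power2_eq_square power3_eq_cube field_simps)
      moreover have "q \<ge> 1"
        using x mult_right_mono[OF x(2) x(1)] by (simp add: q_def a_def power2_eq_square field_simps)
      then have "(x - a)\<^sup>2 \<le> q * (x - a)\<^sup>2"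
        using mult_right_mono[of 1 q "(x - a)\<^sup>2"] by simp
      moreover have "d * (x - a) \<le> (x - a)\<^sup>2 + (d / 2)\<^sup>2"
        using zero_le_power2[of "x - a - d / 2"] by (simp add: power2_eq_square algebra_simps)
      moreover have "3 * a - 2 * a ^ 3 + (1 - a\<^sup>2)\<^sup>2 / 4 + (d / 2)\<^sup>2 \<le> 1.48465755"
        by (simp add: a_def d_def power2_eq_square power3_eq_cube)
      ultimately show ?thesis by linarith
    qed
    finally show ?thesis .
  qed
qed

section \<open>The Hankel determinant\<close>

text \<open>
  The terms in \<open>a\<^sup>6\<close>, \<open>a\<^sup>4 c\<close>, \<open>a\<^sup>3 d\<close> and \<open>a\<^sup>2 c\<^sup>2\<close> cancel. The factor \<open>a\<^sup>2 + c\<close> is kept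
  together because it is \<open>a\<^sub>3\<close>, for which the bound \<open>3\<close> is better than what \<open>|a| \<le> 2\<close> gives.
\<close>

lemma hankel2_3_in_schur_coeffs:
  fixes a c d e :: complex
  shows "(a\<^sup>2 + c) * (a ^ 4 + 3 * a\<^sup>2 * c + a * d + c\<^sup>2 + e / 3) - (a ^ 3 + 2 * a * c + d / 2)\<^sup>2
    = (a\<^sup>2 + c) * (e / 3) - a * c * d + c ^ 3 - (d / 2)\<^sup>2"
  by (simp add: power2_eq_square power3_eq_cube power4_eq_xxxx field_simps)

lemma class_U_hankel_bounds:
  assumes "f \<in> class_U"
  shows "taylor_coeff f 2 = 0 \<Longrightarrow> norm (hankel2 3 f) \<le> 1"
    and "norm (hankel2 3 f) \<le> 1.48465755"
proof -
  define a where "a = taylor_coeff f 2"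
  obtain \<phi> \<Phi> where \<phi>: "schur \<phi>" "\<phi> has_fps_expansion \<Phi>"
    and a3: "taylor_coeff f 3 = a\<^sup>2 + fps_nth \<Phi> 0"
    and a4: "taylor_coeff f 4 = a ^ 3 + 2 * a * fps_nth \<Phi> 0 + fps_nth \<Phi> 1 / 2"
    and a5: "taylor_coeff f 5 = a ^ 4 + 3 * a\<^sup>2 * fps_nth \<Phi> 0 + a * fps_nth \<Phi> 1
       + (fps_nth \<Phi> 0)\<^sup>2 + fps_nth \<Phi> 2 / 3"
    and bounds: "norm a \<le> 2" "norm (taylor_coeff f 3) \<le> 3"
    using class_U_coeffs[OF assms] unfolding a_def by metis
  define c d e where "c = fps_nth \<Phi> 0" and "d = fps_nth \<Phi> 1" and "e = fps_nth \<Phi> 2"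
  define x y u where "x = norm c" and "y = norm d / 2" and "u = norm e / 3"
  have xyu: "0 \<le> x" "x \<le> 1" "0 \<le> y" "y \<le> (1 - x\<^sup>2) / 2" "0 \<le> u"
      "u \<le> (1 - x\<^sup>2 - 4 * y\<^sup>2 / (1 + x)) / 3"
    using schur_coeff_0[OF \<phi>] schur_coeff_1[OF \<phi>] schur_coeff_2[OF \<phi>]
    by (simp_all add: x_def y_def u_def c_def d_def e_def power_divide)
  have H: "hankel2 3 f = (a\<^sup>2 + c) * (e / 3) - a * c * d + c ^ 3 - (d / 2)\<^sup>2"
    using hankel2_3_in_schur_coeffs[of a c d e]
    by (simp add: hankel2_def a3 a4 a5 c_def d_def e_def)
  have "norm (hankel2 3 f) \<le> norm ((a\<^sup>2 + c) * (e / 3)) + norm (a * c * d) + norm (c ^ 3) + norm ((d / 2)\<^sup>2)"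
    unfolding H using norm_triangle_ineq4 norm_triangle_ineq by (smt (verit))
  then have le: "norm (hankel2 3 f) \<le> norm (a\<^sup>2 + c) * u + 2 * norm a * x * y + x ^ 3 + y\<^sup>2"
    by (simp add: x_def y_def u_def norm_mult norm_power norm_divide power_divide)
  show "norm (hankel2 3 f) \<le> 1" if "taylor_coeff f 2 = 0"
    using le that bound_a2_zero[OF xyu(1-4,6)] by (simp add: a_def[symmetric] x_def[symmetric])
  have "norm (a\<^sup>2 + c) * u \<le> 3 * u"
    using bounds(2) xyu by (intro mult_right_mono) (simp_all add: a3 c_def)
  moreover have "2 * norm a * x * y \<le> 2 * 2 * x * y"
    using bounds(1) xyu by (intro mult_right_mono) auto
  ultimately show "norm (hankel2 3 f) \<le> 1.48465755"
    using le bound_general[OF xyu(1-4,6)] by linarith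
qed

section \<open>The extremal function with vanishing second coefficient\<close>

lemma sums_odd_powers:
  fixes z :: complex
  assumes "norm z < 1"
  shows "(\<lambda>n. z ^ (2 * n + 1)) sums (z / (1 - z\<^sup>2))"
proof -
  have "norm (z\<^sup>2) < 1"
    using assms by (simp add: norm_power abs_square_less_1)
  from sums_mult[OF geometric_sums[OF this], of z] show ?thesis
    by (simp add: power_mult)
qed

lemma extremal_class_U:
  "(\<lambda>z::complex. z / (1 - z\<^sup>2)) \<in> class_U"
proof -
  define f :: "complex \<Rightarrow> complex" where "f z = z / (1 - z\<^sup>2)" for z
  have nz: "1 - z\<^sup>2 \<noteq> 0" and lt: "norm (z\<^sup>2) < 1" if "norm z < 1" for z :: complex
  proof -
    show "norm (z\<^sup>2) < 1"
      using that by (simp add: norm_power abs_square_less_1)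
    then show "1 - z\<^sup>2 \<noteq> 0" by force
  qed
  have der: "deriv f z = (1 + z\<^sup>2) / (1 - z\<^sup>2)\<^sup>2" if "norm z < 1" for z
    unfolding f_def[abs_def] using nz[OF that]
    by (intro DERIV_imp_deriv) (auto intro!: derivative_eq_intros simp: power2_eq_square algebra_simps)
  have "f \<in> class_A"
    unfolding class_A_def
    using nz der[of 0] by (auto simp: f_def[abs_def] intro!: holomorphic_intros)
  moreover have "(z_over f z)\<^sup>2 * deriv f z - 1 = z\<^sup>2" if "norm z < 1" for z
    using der[OF that] nz[OF that] by (simp add: z_over_def f_def power_divide)
  moreover have "f z \<noteq> 0" if "norm z < 1" "z \<noteq> 0" for z
    using nz that by (simp add: f_def)
  ultimately have "f \<in> class_U"
    using lt by (simp add: class_U_def)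
  then show ?thesis
    by (simp add: f_def[abs_def])
qed

lemma taylor_coeff_extremal:
  "taylor_coeff (\<lambda>z. z / (1 - z\<^sup>2)) n = (if odd n then 1 else 0)"
proof -
  have "(\<lambda>z::complex. z / (1 - z\<^sup>2)) has_fps_expansion Abs_fps (\<lambda>n. if odd n then 1 else 0)"
  proof (rule has_fps_expansionI)
    have "(\<lambda>n. (if odd n then 1 else 0) * z ^ n) sums (z / (1 - z\<^sup>2))" if "norm z < 1" for z :: complex
    proof -
      have "(\<lambda>n. (if odd (2 * n + 1) then 1 else 0) * z ^ (2 * n + 1)) sums (z / (1 - z\<^sup>2))"
        using sums_odd_powers[OF that] by simp
      \<comment> \<open>The series of odd powers is the full power series with its zero terms left out.\<close>
      then show ?thesis
        by (subst (asm) sums_mono_reindex[of "\<lambda>n. 2 * n + 1"]) (auto simp: strict_mono_def elim!: oddE)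
    qed
    then show "\<forall>\<^sub>F z in nhds 0. (\<lambda>n. fps_nth (Abs_fps (\<lambda>n. if odd n then 1 else 0)) n * z ^ n) sums (z / (1 - z\<^sup>2 :: complex))"
      using eventually_in_unit_disc[of 0] by (auto elim!: eventually_mono)
  qed
  then show ?thesis
    by (simp add: taylor_coeff_def fps_expansion_eqI)
qed

section \<open>The sharp and the general bound\<close>

theorem theorem1:
  shows "(\<forall>f\<in>class_U. taylor_coeff f 2 = 0 \<longrightarrow> norm (hankel2 3 f) \<le> 1)
    \<and> (let f = (\<lambda>z::complex. z / (1 - z\<^sup>2)) in
         f \<in> class_U \<and> taylor_coeff f 2 = 0 \<and> norm (hankel2 3 f) = 1 \<and>
         (\<forall>z\<in>ball 0 1. (\<lambda>n. z ^ (2 * n + 1)) sums f z))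
    \<and> (\<exists>C::real. 1.4846575 \<le> C \<and> C < 1.4846576 \<and>
         (\<forall>f\<in>class_U. norm (hankel2 3 f) \<le> C))"
proof (intro conjI)
  show "\<forall>f\<in>class_U. taylor_coeff f 2 = 0 \<longrightarrow> norm (hankel2 3 f) \<le> 1"
    using class_U_hankel_bounds(1) by blast
  show "let f = (\<lambda>z::complex. z / (1 - z\<^sup>2)) in
         f \<in> class_U \<and> taylor_coeff f 2 = 0 \<and> norm (hankel2 3 f) = 1 \<and>
         (\<forall>z\<in>ball 0 1. (\<lambda>n. z ^ (2 * n + 1)) sums f z)"
    using extremal_class_U sums_odd_powers
    by (simp add: Let_def hankel2_def taylor_coeff_extremal)
  \<comment> \<open>The maximum behind the constant is \<open>1.484657513...\<close>, which leaves room for rounding up.\<close>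
  show "\<exists>C::real. 1.4846575 \<le> C \<and> C < 1.4846576 \<and> (\<forall>f\<in>class_U. norm (hankel2 3 f) \<le> C)"
    using class_U_hankel_bounds(2) by (intro exI[of _ "1.48465755"]) auto
qed

end
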